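(* Let $d\ge 1$, let $\alpha\in C(\mathbb{R}^d)$ satisfy $0<\alpha_{\min}\le \alpha(x)\le \alpha_{\max}<2$ for all $x\in\mathbb{R}^d$, and let $u\in C_b^2(\mathbb{R}^d)$. Then the variable-order fractional Laplacian defined by the singular integral is equivalent to the one defined via the Fourier transform, i.e. $$(-\Delta)^{\alpha(x)/2}u(x)=\mathcal{F}^{-1}\big[|\xi|^{\alpha(x)}\,\mathcal{F}[u](\xi)\big](x),$$ whenever both sides of this equality are well-defined.
   Context: $C_b^2(\mathbb{R}^d)$ is the space of bounded and twice continuously differentiable functions on $\mathbb{R}^d$. The $\alpha(x)$-th order fractional Laplacian is $$(-\Delta)^{\alpha(x)/2}u(x):=c_{d,\alpha(x)}\,\mathrm{P.V.}\int_{\mathbb{R}^d}\frac{u(x)-u(y)}{|x-y|^{d+\alpha(x)}}\,dy,\qquad c_{d,\alpha(x)}:=\frac{2^{\alpha(x)-1}\alpha(x)\,\Gamma\big((\alpha(x)+d)/2\big)}{\pi^{d/2}\,\Gamma\big(1-\alpha(x)/2\big)},$$ where P.V. denotes the principal value (the limit as $\varepsilon\to0^+$ of the integral over $|x-y|>\varepsilon$). The Fourier transform and its inverse are $$\mathcal{F}[u](\xi)=\int_{\mathbb{R}^d}e^{-\mathbf{i}\xi\cdot x}u(x)\,dx,\qquad \mathcal{F}^{-1}[\hat u](x)=\frac{1}{(2\pi)^d}\int_{\mathbb{R}^d}e^{\mathbf{i}\xi\cdot x}\hat u(\xi)\,d\xi .$$ Thus the right-hand side of the claim means, for each fixed $x$,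 $\frac{1}{(2\pi)^d}\int_{\mathbb{R}^d}e^{\mathbf{i}\xi\cdot x}|\xi|^{\alpha(x)}\mathcal{F}[u](\xi)\,d\xi$. "Well-defined" means that the principal value exists and that the integrals defining $\mathcal{F}[u]$ and the inverse transform exist as Lebesgue integrals. *)

theory Defs
  imports "HOL-Analysis.Analysis"
begin

text \<open>
  Only \<open>u\<close> itself is required to be bounded; its derivatives are continuous but may be
  unbounded. \<open>Du\<close> and \<open>D2u\<close> are the first and second Frechet derivatives.
\<close>

definition Cb2 :: "('a::euclidean_space \<Rightarrow> real) set" where
  "Cb2 = {u. bounded (range u) \<and>
     (\<exists>(Du :: 'a \<Rightarrow> 'a \<Rightarrow>\<^sub>L real) (D2u :: 'a \<Rightarrow> 'a \<Rightarrow>\<^sub>L 'a \<Rightarrow>\<^sub>L real).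
        (\<forall>x. (u has_derivative blinfun_apply (Du x)) (at x)) \<and>
        (\<forall>x. (Du has_derivative blinfun_apply (D2u x)) (at x)) \<and>
        continuous_on UNIV D2u)}"

definition frac_const :: "nat \<Rightarrow> real \<Rightarrow> real" where
  "frac_const d a =
     2 powr (a - 1) * a * Gamma ((a + real d) / 2) / (pi powr (real d / 2) * Gamma (1 - a / 2))"

definition frac_integrand ::
    "('a::euclidean_space \<Rightarrow> real) \<Rightarrow> ('a \<Rightarrow> real) \<Rightarrow> 'a \<Rightarrow> 'a \<Rightarrow> real" where
  "frac_integrand \<alpha> u x y = (u x - u y) / norm (x - y) powr (real DIM('a) + \<alpha> x)"

definition pv_trunc :: "('a::euclidean_space \<Rightarrow> real) \<Rightarrow> 'a \<Rightarrow> real \<Rightarrow> real" where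
  "pv_trunc f x \<epsilon> = (LINT y:{y. norm (x - y) > \<epsilon>}|lborel. f y)"

definition pv_exists :: "('a::euclidean_space \<Rightarrow> real) \<Rightarrow> 'a \<Rightarrow> bool" where
  "pv_exists f x \<longleftrightarrow>
     (\<forall>\<epsilon>>0. set_integrable lborel {y. norm (x - y) > \<epsilon>} f) \<and>
     (\<exists>l. (pv_trunc f x \<longlongrightarrow> l) (at_right 0))"

definition pv_integral :: "('a::euclidean_space \<Rightarrow> real) \<Rightarrow> 'a \<Rightarrow> real" where
  "pv_integral f x = Lim (at_right 0) (pv_trunc f x)"

definition frac_laplacian ::
    "('a::euclidean_space \<Rightarrow> real) \<Rightarrow> ('a \<Rightarrow> real) \<Rightarrow> 'a \<Rightarrow> real" where
  "frac_laplacian \<alpha> u x = frac_const DIM('a) (\<alpha> x) * pv_integral (frac_integrand \<alpha> u x) x"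

definition frac_laplacian_defined ::
    "('a::euclidean_space \<Rightarrow> real) \<Rightarrow> ('a \<Rightarrow> real) \<Rightarrow> 'a \<Rightarrow> bool" where
  "frac_laplacian_defined \<alpha> u x \<longleftrightarrow> pv_exists (frac_integrand \<alpha> u x) x"

definition fourier :: "('a::euclidean_space \<Rightarrow> complex) \<Rightarrow> 'a \<Rightarrow> complex" where
  "fourier f \<xi> = (LINT x|lborel. exp (- \<i> * complex_of_real (\<xi> \<bullet> x)) * f x)"

definition fourier_defined :: "('a::euclidean_space \<Rightarrow> complex) \<Rightarrow> 'a \<Rightarrow> bool" where
  "fourier_defined f \<xi> \<longleftrightarrow>
     integrable lborel (\<lambda>x. exp (- \<i> * complex_of_real (\<xi> \<bullet> x)) * f x)"

definition inv_fourier :: "('a::euclidean_space \<Rightarrow> complex) \<Rightarrow> 'a \<Rightarrow> complex" where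
  "inv_fourier g x =
     1 / (2 * complex_of_real pi) ^ DIM('a) *
     (LINT \<xi>|lborel. exp (\<i> * complex_of_real (\<xi> \<bullet> x)) * g \<xi>)"

definition inv_fourier_defined :: "('a::euclidean_space \<Rightarrow> complex) \<Rightarrow> 'a \<Rightarrow> bool" where
  "inv_fourier_defined g x \<longleftrightarrow>
     integrable lborel (\<lambda>\<xi>. exp (\<i> * complex_of_real (\<xi> \<bullet> x)) * g \<xi>)"

text \<open>
  In the symbol $|\xi|^{\alpha(x)}$ the point \<open>x\<close> is a fixed parameter, equal to the point at which the
  inverse transform is evaluated.
\<close>

definition frac_symbol ::
    "('a::euclidean_space \<Rightarrow> real) \<Rightarrow> ('a \<Rightarrow> real) \<Rightarrow> 'a \<Rightarrow> 'a \<Rightarrow> complex" where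
  "frac_symbol \<alpha> u x \<xi> =
     complex_of_real (norm \<xi> powr \<alpha> x) * fourier (\<lambda>y. complex_of_real (u y)) \<xi>"

definition fourier_frac_laplacian ::
    "('a::euclidean_space \<Rightarrow> real) \<Rightarrow> ('a \<Rightarrow> real) \<Rightarrow> 'a \<Rightarrow> complex" where
  "fourier_frac_laplacian \<alpha> u x = inv_fourier (frac_symbol \<alpha> u x) x"

definition fourier_frac_laplacian_defined ::
    "('a::euclidean_space \<Rightarrow> real) \<Rightarrow> ('a \<Rightarrow> real) \<Rightarrow> 'a \<Rightarrow> bool" where
  "fourier_frac_laplacian_defined \<alpha> u x \<longleftrightarrow>
     (\<forall>\<xi>. fourier_defined (\<lambda>y. complex_of_real (u y)) \<xi>) \<and>
     inv_fourier_defined (frac_symbol \<alpha> u x) x"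

end

theory Submission
  imports Defs "HOL-Probability.Characteristic_Functions"
begin

text \<open>
  Fix \<open>x\<close>, write \<open>d\<close> for the dimension and \<open>a\<close> for the order \<open>\<alpha> x\<close> at that point, so that
  \<open>0 < a < 2\<close>.

  The function \<open>\<bar>\<xi>\<bar>\<^sup>a\<close> is itself a singular integral: the integral of
  \<open>(1 - cos (\<xi> \<bullet> z)) / \<bar>z\<bar>\<^bsup>d + a\<^esup>\<close> over \<open>z\<close> equals \<open>\<bar>\<xi>\<bar>\<^sup>a / frac_const d a\<close>
  (\<open>nn_integral_levy_kernel\<close>). The power of \<open>\<bar>z\<bar>\<close> is a mixture of Gaussians and the Fourier transform
  of a Gaussian is explicit, so Tonelli reduces this to one-dimensional \<open>Gamma\<close> integrals, which give the
  constant exactly.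

  Existence of the two transforms makes \<open>u\<close> and \<open>\<bar>\<xi>\<bar>\<^sup>a\<close> times its Fourier transform integrable. The
  weight is small only near the origin, where the transform is bounded, so the transform itself is
  integrable, and the inversion formula holds at every point because \<open>u\<close>
  is bounded and continuous (\<open>fourier_inversion\<close>). It represents the second difference
  \<open>u x - (u (x + z) + u (x - z)) / 2\<close> as an integral over \<open>\<xi>\<close> in which \<open>z\<close> occurs only through
  \<open>1 - cos (\<xi> \<bullet> z)\<close>. Dividing by \<open>\<bar>z\<bar>\<^bsup>d + a\<^esup>\<close> and integrating over \<open>z\<close>, Fubini and the formula for
  \<open>\<bar>\<xi>\<bar>\<^sup>a\<close> yield the Fourier side (\<open>second_difference_integral\<close>); the absolute convergence that Fubini
  needs is exactly the integrability of the weighted transform.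

  Finally, the regions \<open>\<bar>x - y\<bar> > \<epsilon>\<close> are symmetric about \<open>x\<close>, so in the principal value the first
  difference may be replaced by the second difference, whose quotient has just been seen to be
  integrable over the whole space; dominated convergence removes the truncation
  (\<open>pv_integral_eq_second_difference\<close>).
\<close>

section \<open>The Fourier transform of a Gaussian\<close>

text \<open>
  Up to the substitution \<open>x \<mapsto> sqrt (2 * t) * x\<close> this is the characteristic function of the standard
  normal distribution.
\<close>

lemma gaussian_fourier_real:
  fixes t \<xi> :: real
  assumes t: "t > 0"
  shows "integrable lborel (\<lambda>x. iexp (\<xi> * x) * complex_of_real (exp (- t * x\<^sup>2)))"
    and "(LINT x|lborel. iexp (\<xi> * x) * complex_of_real (exp (- t * x\<^sup>2)))
           = complex_of_real (sqrt (pi / t) * exp (- \<xi>\<^sup>2 / (4 * t)))"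
proof -
  define c where "c = sqrt (2 * t)"
  have c: "c > 0" "c\<^sup>2 = 2 * t" using t by (auto simp: c_def)
  define f :: "real \<Rightarrow> complex" where "f = (\<lambda>x. std_normal_density x *\<^sub>R iexp (\<xi> / c * x))"
  have fint: "integrable lborel f"
    unfolding f_def
    by (rule Bochner_Integration.integrable_bound[of _ "std_normal_density"])
       (auto simp: integrable_normal_density)
  have feq: "(LINT x|lborel. f x) = complex_of_real (exp (- (\<xi> / c)\<^sup>2 / 2))"
    using fun_cong[OF char_std_normal_distribution, of "\<xi> / c"]
    unfolding char_def f_def
    by (subst (asm) integral_density) auto
  have fc: "iexp (\<xi> * x) * complex_of_real (exp (- t * x\<^sup>2)) = complex_of_real (sqrt (2 * pi)) * f (0 + c * x)" for x
    using c by (simp add: f_def std_normal_density_def power_mult_distrib scaleR_conv_of_real)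
  show "integrable lborel (\<lambda>x. iexp (\<xi> * x) * complex_of_real (exp (- t * x\<^sup>2)))"
    unfolding fc using c fint by (intro integrable_mult_right lborel_integrable_real_affine) auto
  have "complex_of_real (exp (- (\<xi> / c)\<^sup>2 / 2)) = c *\<^sub>R (LINT x|lborel. f (0 + c * x))"
    using lborel_integral_real_affine[of c f 0] c feq by simp
  then have *: "(LINT x|lborel. f (0 + c * x)) = complex_of_real (exp (- (\<xi> / c)\<^sup>2 / 2) / c)"
    using c by (simp add: scaleR_conv_of_real field_simps)
  have "(LINT x|lborel. iexp (\<xi> * x) * complex_of_real (exp (- t * x\<^sup>2)))
      = complex_of_real (sqrt (2 * pi) * (exp (- (\<xi> / c)\<^sup>2 / 2) / c))"
    unfolding fc integral_mult_right_zero * by simp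
  also have "sqrt (2 * pi) * (exp (- (\<xi> / c)\<^sup>2 / 2) / c) = sqrt (pi / t) * exp (- \<xi>\<^sup>2 / (4 * t))"
    using t c by (simp add: power_divide real_sqrt_divide real_sqrt_mult c_def)
  finally show "(LINT x|lborel. iexp (\<xi> * x) * complex_of_real (exp (- t * x\<^sup>2)))
           = complex_of_real (sqrt (pi / t) * exp (- \<xi>\<^sup>2 / (4 * t)))" .
qed

lemma integral_lborel_prod:
  fixes f :: "'a::euclidean_space \<Rightarrow> real \<Rightarrow> 'b::{real_normed_field, banach, second_countable_topology}"
  assumes f: "\<And>b. b \<in> Basis \<Longrightarrow> integrable lborel (f b)"
  shows "integrable lborel (\<lambda>x::'a. \<Prod>b\<in>Basis. f b (x \<bullet> b))"
    and "(LINT x|lborel. (\<Prod>b\<in>Basis. f b (x \<bullet> b))) = (\<Prod>b\<in>Basis. LINT x|lborel. f b x)"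
proof -
  interpret product_sigma_finite "\<lambda>_::'a. lborel :: real measure" ..
  have [measurable]: "f b \<in> borel_measurable borel" if "b \<in> Basis" for b
    using borel_measurable_integrable[OF f[OF that]] by simp
  have m: "(\<lambda>x::'a. \<Prod>b\<in>Basis. f b (x \<bullet> b)) \<in> borel_measurable borel"
    by measurable
  have T: "(\<lambda>g. \<Sum>b\<in>Basis. g b *\<^sub>R b :: 'a) \<in> measurable (\<Pi>\<^sub>M b\<in>Basis. lborel) borel"
    by measurable
  have eq: "(\<Prod>b\<in>Basis. f b ((\<Sum>b\<in>Basis. g b *\<^sub>R b) \<bullet> b)) = (\<Prod>b\<in>Basis. f b (g b))" for g :: "'a \<Rightarrow> real"
    by (intro prod.cong) auto
  show "integrable lborel (\<lambda>x::'a. \<Prod>b\<in>Basis. f b (x \<bullet> b))"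
    by (subst lborel_eq, subst integrable_distr_eq[OF T m])
       (simp only: eq, intro product_integrable_prod f finite_Basis)
  show "(LINT x|lborel. (\<Prod>b\<in>Basis. f b (x \<bullet> b))) = (\<Prod>b\<in>Basis. LINT x|lborel. f b x)"
    by (subst lborel_eq, subst integral_distr[OF T m])
       (simp only: eq, intro product_integral_prod f finite_Basis)
qed

text \<open>
  Both the Gaussian and the character \<open>iexp (\<xi> \<bullet> x)\<close> factor over the coordinates, so the integral
  is a product of one-dimensional ones.
\<close>

lemma gaussian_fourier:
  fixes \<xi> :: "'a::euclidean_space"
  assumes t: "t > 0"
  shows "integrable lborel (\<lambda>x. iexp (\<xi> \<bullet> x) * complex_of_real (exp (- t * (norm x)\<^sup>2)))" (is ?i)
    and "(LINT x|lborel. iexp (\<xi> \<bullet> x) * complex_of_real (exp (- t * (norm x)\<^sup>2)))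
           = complex_of_real (sqrt (pi / t) ^ DIM('a) * exp (- (norm \<xi>)\<^sup>2 / (4 * t)))" (is ?e)
proof -
  let ?f = "\<lambda>b s. iexp ((\<xi> \<bullet> b) * s) * complex_of_real (exp (- t * s\<^sup>2))"
  have n: "(norm y)\<^sup>2 = (\<Sum>b\<in>Basis. (y \<bullet> b)\<^sup>2)" for y :: 'a
    unfolding power2_norm_eq_inner by (subst euclidean_inner) (simp add: power2_eq_square)
  have eq: "iexp (\<xi> \<bullet> x) * complex_of_real (exp (- t * (norm x)\<^sup>2)) = (\<Prod>b\<in>Basis. ?f b (x \<bullet> b))" for x :: 'a
    unfolding n
    by (subst euclidean_inner)
       (simp add: prod.distrib sum_distrib_left exp_sum[symmetric] sum_negf[symmetric]
          flip: exp_of_real)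
  note int = gaussian_fourier_real[OF t]
  show ?i unfolding eq by (rule integral_lborel_prod) (rule int)
  have "(LINT x|lborel. iexp (\<xi> \<bullet> x) * complex_of_real (exp (- t * (norm x)\<^sup>2)))
      = (\<Prod>b::'a\<in>Basis. complex_of_real (sqrt (pi / t) * exp (- (\<xi> \<bullet> b)\<^sup>2 / (4 * t))))"
    unfolding eq by (subst integral_lborel_prod) (auto simp only: int intro: int)
  also have "\<dots> = complex_of_real (sqrt (pi / t) ^ DIM('a) * exp (- (norm \<xi>)\<^sup>2 / (4 * t)))"
    unfolding n by (simp add: prod.distrib sum_divide_distrib exp_sum[symmetric] sum_negf[symmetric]
       flip: of_real_prod)
  finally show ?e .
qed

section \<open>The symbol as a singular integral\<close>

text \<open>
  Euler's integral for \<open>Gamma\<close>, rescaled. Read from right to left with \<open>r = (norm z)\<^sup>2\<close>, it writes a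
  negative power of \<open>norm z\<close> as a mixture of Gaussians.
\<close>

lemma nn_integral_powr_exp:
  fixes q r :: real
  assumes q: "q > 0" and r: "r > 0"
  shows "(\<integral>\<^sup>+t. ennreal (indicator {0..} t * t powr (q - 1) * exp (- (r * t))) \<partial>lborel)
           = ennreal (Gamma q / r powr q)"
proof -
  let ?F = "\<lambda>t::real. ennreal (indicator {0..} t * t powr (q - 1) / exp t)"
  have eq: "ennreal (indicator {0..} t * t powr (q - 1) * exp (- (r * t)))
      = ennreal (1 / r powr q) * (ennreal \<bar>r\<bar> * ?F (0 + r * t))" for t
  proof -
    have "r powr q = r * r powr (q - 1)" using r by (simp add: powr_diff)
    then have "indicator {0..} t * t powr (q - 1) * exp (- (r * t))
        = 1 / r powr q * (\<bar>r\<bar> * (indicator {0..} (0 + r * t) * (0 + r * t) powr (q - 1) / exp (0 + r * t)))"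
      using r by (auto simp: powr_mult exp_minus field_simps indicator_def zero_le_mult_iff)
    then show ?thesis using r by (simp add: ennreal_mult[symmetric])
  qed
  have "(\<integral>\<^sup>+t. ennreal (indicator {0..} t * t powr (q - 1) * exp (- (r * t))) \<partial>lborel)
      = ennreal (1 / r powr q) * (ennreal \<bar>r\<bar> * (\<integral>\<^sup>+t. ?F (0 + r * t) \<partial>lborel))"
    unfolding eq by (simp add: nn_integral_cmult)
  also have "\<dots> = ennreal (1 / r powr q) * (\<integral>\<^sup>+t. ?F t \<partial>lborel)"
    using r by (subst nn_integral_real_affine[of ?F r 0]) auto
  also have "\<dots> = ennreal (Gamma q / r powr q)"
    using q r by (subst Gamma_conv_nn_integral_real[symmetric]) (auto simp: ennreal_mult[symmetric])
  finally show ?thesis .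
qed

text \<open>
  Writing \<open>1 - exp (- b / t)\<close> as the integral of \<open>b * exp (- (b * v))\<close> over \<open>0 < v \<le> 1 / t\<close> and
  integrating first over \<open>0 < t \<le> 1 / v\<close> turns the left-hand side into an Euler integral in \<open>v\<close>. The
  conditions on \<open>s\<close> are convergence at \<open>t = \<infinity>\<close> (\<open>s < 1\<close>) and at \<open>t = 0\<close> (\<open>0 < s\<close>).
\<close>

lemma nn_integral_powr_one_minus_exp_inverse:
  fixes s b :: real
  assumes s: "0 < s" "s < 1" and b: "b > 0"
  shows "(\<integral>\<^sup>+t. ennreal (indicator {0..} t * t powr (s - 1) * (1 - exp (- b / t))) \<partial>lborel)
           = ennreal (b powr s * Gamma (1 - s) / s)"
proof -
  \<comment> \<open>The null set \<open>v = 0\<close> is left out, because there the integral over \<open>t\<close> would be infinite.\<close>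
  define G where "G = (\<lambda>(t, v). ennreal (if 0 < t \<and> 0 < v \<and> t * v \<le> 1
     then t powr (s - 1) * (b * exp (- (b * v))) else 0))"
  have [measurable]: "G \<in> borel_measurable (lborel \<Otimes>\<^sub>M lborel)"
    unfolding G_def case_prod_beta' by measurable
  have 1: "ennreal (indicator {0..} t * t powr (s - 1) * (1 - exp (- b / t))) = (\<integral>\<^sup>+v. G (t, v) \<partial>lborel)" for t
  proof (cases "t > 0")
    case True
    have "(\<integral>\<^sup>+v. G (t, v) \<partial>lborel)
        = (\<integral>\<^sup>+v. ennreal (t powr (s - 1)) * (ennreal (b * exp (- (b * v))) * indicator {0..1 / t} v) \<partial>lborel)"
    proof (rule nn_integral_cong_AE, use AE_lborel_singleton[of "0::real"] in eventually_elim)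
      case (elim v)
      then have "v \<in> {0..1 / t} \<longleftrightarrow> 0 < v \<and> t * v \<le> 1"
        using True by (auto simp: pos_le_divide_eq mult.commute)
      then show ?case using True b
        by (simp add: G_def indicator_def ennreal_mult'[symmetric])
    qed
    also have "\<dots> = ennreal (t powr (s - 1)) * (\<integral>\<^sup>+v. ennreal (b * exp (- (b * v))) * indicator {0..1 / t} v \<partial>lborel)"
      by (subst nn_integral_cmult) auto
    also have "(\<integral>\<^sup>+v. ennreal (b * exp (- (b * v))) * indicator {0..1 / t} v \<partial>lborel)
        = ennreal (- exp (- (b * (1 / t))) - - exp (- (b * 0)))"
      using True b
      by (intro nn_integral_FTC_Icc) (auto intro!: derivative_eq_intros)
    finally show ?thesis using True by (simp add: ennreal_mult'[symmetric])
  qed (auto simp: G_def indicator_def)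
  have 2: "(\<integral>\<^sup>+t. G (t, v) \<partial>lborel)
      = ennreal (b / s) * ennreal (indicator {0..} v * v powr ((1 - s) - 1) * exp (- (b * v)))" if "v \<noteq> 0" for v
  proof (cases "v > 0")
    case True
    have "((\<lambda>t. t powr (s - 1)) has_integral ((1 / v) powr (s - 1 + 1) / (s - 1 + 1))) {0..1 / v}"
      using s True by (intro has_integral_powr_from_0) auto
    then have "((\<lambda>t. if t \<in> {0..1 / v} then t powr (s - 1) else 0) has_integral ((1 / v) powr s / s)) UNIV"
      unfolding has_integral_restrict_UNIV by simp
    moreover have "(\<lambda>t. if t \<in> {0..1 / v} then t powr (s - 1) else 0) = (\<lambda>t. indicator {0..1 / v} t * t powr (s - 1))"
      by (auto simp: indicator_def)
    ultimately have "((\<lambda>t. indicator {0..1 / v} t * t powr (s - 1)) has_integral ((1 / v) powr s / s)) UNIV"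
      by simp
    then have *: "(\<integral>\<^sup>+t. ennreal (indicator {0..1 / v} t * t powr (s - 1)) \<partial>lborel) = ennreal ((1 / v) powr s / s)"
      by (intro nn_integral_has_integral_lborel) auto
    have "(\<integral>\<^sup>+t. G (t, v) \<partial>lborel)
       = (\<integral>\<^sup>+t. ennreal (b * exp (- (b * v))) * ennreal (indicator {0..1 / v} t * t powr (s - 1)) \<partial>lborel)"
    proof (rule nn_integral_cong_AE, use AE_lborel_singleton[of "0::real"] in eventually_elim)
      case (elim t)
      then have "t \<in> {0..1 / v} \<longleftrightarrow> 0 < t \<and> t * v \<le> 1"
        using True by (auto simp: pos_le_divide_eq)
      then show ?case using True b
        by (simp add: G_def indicator_def ennreal_mult'[symmetric] mult_ac)
    qed
    also have "\<dots> = ennreal (b * exp (- (b * v))) * ennreal ((1 / v) powr s / s)"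
      by (subst nn_integral_cmult) (auto simp: *)
    also have "\<dots> = ennreal (b / s) * ennreal (indicator {0..} v * v powr ((1 - s) - 1) * exp (- (b * v)))"
      using True b s by (simp add: ennreal_mult'[symmetric] powr_divide powr_minus divide_simps)
    finally show ?thesis .
  qed (use that in \<open>auto simp: G_def indicator_def\<close>)
  have "(\<integral>\<^sup>+t. ennreal (indicator {0..} t * t powr (s - 1) * (1 - exp (- b / t))) \<partial>lborel)
      = (\<integral>\<^sup>+t. \<integral>\<^sup>+v. G (t, v) \<partial>lborel \<partial>lborel)"
    unfolding 1 ..
  also have "\<dots> = (\<integral>\<^sup>+v. \<integral>\<^sup>+t. G (t, v) \<partial>lborel \<partial>lborel)"
    by (rule lborel_pair.Fubini') (simp add: case_prod_beta')
  also have "\<dots> = (\<integral>\<^sup>+v. ennreal (b / s) * ennreal (indicator {0..} v * v powr ((1 - s) - 1) * exp (- (b * v))) \<partial>lborel)"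
    by (rule nn_integral_cong_AE, use AE_lborel_singleton[of "0::real"] in eventually_elim) (rule 2)
  also have "\<dots> = ennreal (b / s) * ennreal (Gamma (1 - s) / b powr (1 - s))"
    using s b by (subst nn_integral_cmult) (measurable, subst nn_integral_powr_exp, simp_all)
  also have "\<dots> = ennreal (b powr s * Gamma (1 - s) / s)"
  proof -
    have "b / s * (Gamma (1 - s) / b powr (1 - s)) = b powr s * Gamma (1 - s) / s"
      using b by (simp add: powr_diff)
    then show ?thesis using s b by (simp add: ennreal_mult'[symmetric])
  qed
  finally show ?thesis .
qed

lemma frac_const_pos: "0 < a \<Longrightarrow> a < 2 \<Longrightarrow> frac_const d a > 0"
  unfolding frac_const_def by (intro divide_pos_pos mult_pos_pos Gamma_real_pos) auto

lemma nn_integral_gaussian_one_minus_cos: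
  fixes \<xi> :: "'a::euclidean_space"
  assumes t: "t > 0"
  shows "(\<integral>\<^sup>+z. ennreal (exp (- t * (norm z)\<^sup>2) * (1 - cos (\<xi> \<bullet> z))) \<partial>lborel)
           = ennreal (sqrt (pi / t) ^ DIM('a) * (1 - exp (- (norm \<xi>)\<^sup>2 / (4 * t))))"
proof -
  let ?g = "\<lambda>\<xi> x::'a. iexp (\<xi> \<bullet> x) * complex_of_real (exp (- t * (norm x)\<^sup>2))"
  have Re: "Re (?g 0 z - ?g \<xi> z) = exp (- t * (norm z)\<^sup>2) * (1 - cos (\<xi> \<bullet> z))" for z
    by (simp add: Re_exp algebra_simps)
  have int: "integrable lborel (\<lambda>z. ?g 0 z - ?g \<xi> z)"
    by (intro Bochner_Integration.integrable_diff gaussian_fourier(1) t)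
  have "(LINT z|lborel. ?g 0 z - ?g \<xi> z) = (LINT z|lborel. ?g 0 z) - (LINT z|lborel. ?g \<xi> z)"
    by (intro Bochner_Integration.integral_diff gaussian_fourier(1) t)
  also have "\<dots> = complex_of_real (sqrt (pi / t) ^ DIM('a) * (1 - exp (- (norm \<xi>)\<^sup>2 / (4 * t))))"
    unfolding gaussian_fourier(2)[OF t] by (simp add: algebra_simps)
  finally have "(LINT z|lborel. Re (?g 0 z - ?g \<xi> z)) = sqrt (pi / t) ^ DIM('a) * (1 - exp (- (norm \<xi>)\<^sup>2 / (4 * t)))"
    using integral_Re[OF int] by (simp only: Re_complex_of_real)
  with integrable_Re[OF int] show ?thesis
    unfolding Re by (subst nn_integral_eq_integral) simp_all
qed

text \<open>
  This is where the normalising constant of the fractional Laplacian comes from. The power of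
  \<open>norm z\<close> is a mixture of Gaussians \<open>exp (- t * (norm z)\<^sup>2)\<close>; integrating over \<open>z\<close> first, each of
  them contributes a multiple of \<open>1 - exp (- (norm \<xi>)\<^sup>2 / (4 * t))\<close>, and the remaining integral over
  \<open>t\<close> is the one-dimensional one above with \<open>s = a / 2\<close> and \<open>b = (norm \<xi>)\<^sup>2 / 4\<close>.
\<close>

lemma nn_integral_levy_kernel:
  fixes \<xi> :: "'a::euclidean_space"
  assumes a: "0 < a" "a < 2"
  shows "(\<integral>\<^sup>+z. ennreal ((1 - cos (\<xi> \<bullet> z)) / norm z powr (real DIM('a) + a)) \<partial>lborel)
           = ennreal (norm \<xi> powr a / frac_const DIM('a) a)"
proof (cases "\<xi> = 0")
  case False
  define p where "p = real DIM('a) + a"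
  have p: "p > 0" using a by (simp add: p_def)
  define C where "C = 1 / Gamma (p / 2)"
  have C: "C > 0" using p by (simp add: C_def)
  define H where "H = (\<lambda>(z::'a, t::real). ennreal (C * (indicator {0..} t * t powr (p / 2 - 1))
      * (exp (- t * (norm z)\<^sup>2) * (1 - cos (\<xi> \<bullet> z)))))"
  have [measurable]: "H \<in> borel_measurable (lborel \<Otimes>\<^sub>M lborel)"
    unfolding H_def by measurable
  have 1: "ennreal ((1 - cos (\<xi> \<bullet> z)) / norm z powr p) = (\<integral>\<^sup>+t. H (z, t) \<partial>lborel)" for z
  proof (cases "z = 0")
    case False
    have "(\<integral>\<^sup>+t. H (z, t) \<partial>lborel) = (\<integral>\<^sup>+t. ennreal (C * (1 - cos (\<xi> \<bullet> z)))
        * ennreal (indicator {0..} t * t powr (p / 2 - 1) * exp (- ((norm z)\<^sup>2 * t))) \<partial>lborel)"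
      using C by (intro nn_integral_cong) (simp add: H_def ennreal_mult'[symmetric] mult_ac)
    also have "\<dots> = ennreal (C * (1 - cos (\<xi> \<bullet> z))) * ennreal (Gamma (p / 2) / ((norm z)\<^sup>2) powr (p / 2))"
      using False p by (subst nn_integral_cmult) (auto simp: nn_integral_powr_exp)
    also have "((norm z)\<^sup>2) powr (p / 2) = norm z powr p"
      using False by (simp add: powr_powr flip: powr_numeral)
    also have "ennreal (C * (1 - cos (\<xi> \<bullet> z))) * ennreal (Gamma (p / 2) / norm z powr p)
        = ennreal ((1 - cos (\<xi> \<bullet> z)) / norm z powr p)"
      using C p Gamma_real_pos[of "p/2"] by (subst ennreal_mult[symmetric]) (auto simp: C_def Gamma_real_pos less_imp_neq[THEN not_sym])
    finally show ?thesis ..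
  qed (simp add: H_def)
  define b where "b = (norm \<xi>)\<^sup>2 / 4"
  have b: "b > 0" using False by (simp add: b_def)
  have 2: "(\<integral>\<^sup>+z. H (z, t) \<partial>lborel)
     = ennreal (C * pi powr (DIM('a) / 2)) * ennreal (indicator {0..} t * t powr (a / 2 - 1) * (1 - exp (- b / t)))" for t
  proof (cases "t > 0")
    case True
    have "(\<integral>\<^sup>+z. H (z, t) \<partial>lborel) = (\<integral>\<^sup>+z. ennreal (C * t powr (p / 2 - 1)) *
        ennreal (exp (- t * (norm z)\<^sup>2) * (1 - cos (\<xi> \<bullet> z))) \<partial>lborel)"
      using True C by (intro nn_integral_cong) (simp add: H_def ennreal_mult'[symmetric])
    also have "\<dots> = ennreal (C * t powr (p / 2 - 1)) * ennreal (sqrt (pi / t) ^ DIM('a) * (1 - exp (- (norm \<xi>)\<^sup>2 / (4 * t))))"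
      using True by (subst nn_integral_cmult) (simp_all only: nn_integral_gaussian_one_minus_cos, measurable)
    also have "sqrt (pi / t) ^ DIM('a) = pi powr (DIM('a) / 2) / t powr (DIM('a) / 2)"
      using True by (simp add: powr_half_sqrt[symmetric] powr_powr powr_divide flip: powr_realpow)
    also have "- (norm \<xi>)\<^sup>2 / (4 * t) = - b / t" by (simp add: b_def)
    also have "ennreal (C * t powr (p / 2 - 1)) * ennreal (pi powr (DIM('a) / 2) / t powr (DIM('a) / 2) * (1 - exp (- b / t)))
      = ennreal (C * pi powr (DIM('a) / 2)) * ennreal (indicator {0..} t * t powr (a / 2 - 1) * (1 - exp (- b / t)))"
    proof -
      have "t powr (p / 2 - 1) = t powr (DIM('a) / 2) * t powr (a / 2 - 1)"
        by (simp add: p_def powr_add[symmetric] add_divide_distrib add_diff_eq)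
      then show ?thesis using True C by (simp add: ennreal_mult'[symmetric] mult_ac)
    qed
    finally show ?thesis .
  qed (auto simp: H_def indicator_def)
  have "(\<integral>\<^sup>+z. ennreal ((1 - cos (\<xi> \<bullet> z)) / norm z powr p) \<partial>lborel)
      = (\<integral>\<^sup>+z. \<integral>\<^sup>+t. H (z, t) \<partial>lborel \<partial>lborel)"
    unfolding 1 ..
  also have "\<dots> = (\<integral>\<^sup>+t. \<integral>\<^sup>+z. H (z, t) \<partial>lborel \<partial>lborel)"
    by (rule lborel_pair.Fubini') (simp add: case_prod_beta')
  also have "\<dots> = ennreal (C * pi powr (DIM('a) / 2)) * ennreal (b powr (a / 2) * Gamma (1 - a / 2) / (a / 2))"
    unfolding 2 using nn_integral_powr_one_minus_exp_inverse[of "a / 2" b] a b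
    by (subst nn_integral_cmult) simp_all
  also have "\<dots> = ennreal (C * pi powr (DIM('a) / 2) * (b powr (a / 2) * Gamma (1 - a / 2) / (a / 2)))"
    using C by (subst ennreal_mult'[symmetric]) auto
  also have "b powr (a / 2) = norm \<xi> powr a / 2 powr a"
  proof -
    have "b = (norm \<xi> / 2) powr 2" using False by (simp add: b_def power_divide)
    then have "b powr (a / 2) = (norm \<xi> / 2) powr (2 * (a / 2))"
      by (simp only: powr_powr)
    then show ?thesis by (simp add: powr_divide)
  qed
  also have "C * pi powr (DIM('a) / 2) * (norm \<xi> powr a / 2 powr a * Gamma (1 - a / 2) / (a / 2))
      = norm \<xi> powr a / frac_const DIM('a) a"
  proof -
    have *: "(2::real) powr (a - 1) = 2 powr a / 2" by (simp add: powr_diff)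
    show ?thesis unfolding frac_const_def C_def p_def * by (simp add: add.commute mult_ac)
  qed
  finally show ?thesis unfolding p_def .
qed simp

lemma integral_levy_kernel:
  fixes \<xi> :: "'a::euclidean_space"
  assumes a: "0 < a" "a < 2"
  shows "integrable lborel (\<lambda>z. (1 - cos (\<xi> \<bullet> z)) / norm z powr (real DIM('a) + a))"
    and "(LINT z|lborel. (1 - cos (\<xi> \<bullet> z)) / norm z powr (real DIM('a) + a))
           = norm \<xi> powr a / frac_const DIM('a) a"
proof -
  have "has_bochner_integral lborel (\<lambda>z. (1 - cos (\<xi> \<bullet> z)) / norm z powr (real DIM('a) + a))
      (norm \<xi> powr a / frac_const DIM('a) a)"
    using frac_const_pos[OF a, of "DIM('a)"]
    by (intro has_bochner_integral_nn_integral nn_integral_levy_kernel a) auto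
  then show "integrable lborel (\<lambda>z. (1 - cos (\<xi> \<bullet> z)) / norm z powr (real DIM('a) + a))"
    and "(LINT z|lborel. (1 - cos (\<xi> \<bullet> z)) / norm z powr (real DIM('a) + a))
           = norm \<xi> powr a / frac_const DIM('a) a"
    by (simp_all add: has_bochner_integral_iff)
qed

section \<open>Affine substitutions\<close>

lemma lborel_integral_affine:
  fixes f :: "'a::euclidean_space \<Rightarrow> 'b::{banach, second_countable_topology}"
  assumes [measurable]: "f \<in> borel_measurable borel" and c: "c \<noteq> 0"
  shows "(LINT x|lborel. f x) = \<bar>c\<bar> ^ DIM('a) *\<^sub>R (LINT x|lborel. f (t + c *\<^sub>R x))"
  by (subst lborel_affine[OF c, of t], subst integral_density)
     (auto simp: integral_distr)

lemma lborel_integrable_affine: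
  fixes f :: "'a::euclidean_space \<Rightarrow> 'b::{banach, second_countable_topology}"
  assumes f: "integrable lborel f" and c: "c \<noteq> 0"
  shows "integrable lborel (\<lambda>x. f (t + c *\<^sub>R x))"
proof -
  have [measurable]: "f \<in> borel_measurable borel"
    using borel_measurable_integrable[OF f] by simp
  have "integrable (density (distr lborel borel (\<lambda>x. t + c *\<^sub>R x)) (\<lambda>_. ennreal (\<bar>c\<bar> ^ DIM('a)))) f"
    using f by (simp add: lborel_affine[OF c, of t, symmetric])
  then have "integrable (distr lborel borel (\<lambda>x. t + c *\<^sub>R x)) (\<lambda>x. \<bar>c\<bar> ^ DIM('a) *\<^sub>R f x)"
    by (subst (asm) integrable_density) auto
  then have "integrable (distr lborel borel (\<lambda>x. t + c *\<^sub>R x))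
      (\<lambda>x. inverse (\<bar>c\<bar> ^ DIM('a)) *\<^sub>R (\<bar>c\<bar> ^ DIM('a) *\<^sub>R f x))"
    by (rule integrable_scaleR_right)
  moreover have "(\<lambda>x. inverse (\<bar>c\<bar> ^ DIM('a)) *\<^sub>R (\<bar>c\<bar> ^ DIM('a) *\<^sub>R f x)) = f"
    using c by auto
  ultimately have "integrable (distr lborel borel (\<lambda>x. t + c *\<^sub>R x)) f"
    by (simp only:)
  then show ?thesis by (subst (asm) integrable_distr_eq) auto
qed

section \<open>Fourier transform and inversion\<close>

lemma norm_exp_minus_i [simp]: "norm (exp (- \<i> * complex_of_real r)) = 1"
  using norm_exp_i_times[of "-r"] by simp

lemma borel_measurable_fourier [measurable]:
  fixes f :: "'a::euclidean_space \<Rightarrow> complex"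
  assumes [measurable]: "f \<in> borel_measurable borel"
  shows "fourier f \<in> borel_measurable borel"
proof -
  have "(\<lambda>\<xi>. LINT x|lborel. exp (- \<i> * complex_of_real (\<xi> \<bullet> x)) * f x) \<in> borel_measurable (lborel :: 'a measure)"
    by (rule lborel.borel_measurable_lebesgue_integral) measurable
  then show ?thesis by (simp add: fourier_def[abs_def])
qed

lemma norm_fourier_le: "norm (fourier f \<xi>) \<le> (LINT x|lborel. norm (f x))"
  unfolding fourier_def by (rule order_trans[OF integral_norm_bound]) (simp add: norm_mult)

lemma integrable_exp_mult:
  fixes f :: "'a::euclidean_space \<Rightarrow> complex" and g :: "'a \<Rightarrow> real"
  assumes "integrable lborel f" "g \<in> borel_measurable borel"
  shows "integrable lborel (\<lambda>x. exp (\<i> * complex_of_real (g x)) * f x)"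
  by (rule Bochner_Integration.integrable_bound[OF assms(1)])
     (use assms borel_measurable_integrable[OF assms(1)] in \<open>auto simp: norm_mult\<close>)

text \<open>
  Damping the inversion integral by \<open>exp (- s\<^sup>2 * (norm \<xi>)\<^sup>2)\<close> makes Fubini applicable, and the
  damped integral is the average of \<open>f\<close> against a Gaussian of width proportional to \<open>s\<close> around
  \<open>y\<close>. Let \<open>s\<close> tend to 0: the damping disappears because \<open>fourier f\<close> is integrable, and the
  averages tend to \<open>f y\<close> because \<open>f\<close> is bounded and continuous.
\<close>

theorem fourier_inversion:
  fixes f :: "'a::euclidean_space \<Rightarrow> complex"
  assumes cont: "continuous_on UNIV f" and bdd: "bounded (range f)"
    and f: "integrable lborel f" and ft: "integrable lborel (fourier f)"
  shows "inv_fourier (fourier f) y = f y"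
proof -
  define s where "s = (\<lambda>n. inverse (real (Suc n)))"
  have s: "s n > 0" for n by (simp add: s_def)
  have s0: "s \<longlonglongrightarrow> 0" unfolding s_def by (rule LIMSEQ_inverse_real_of_nat)
  have [measurable]: "f \<in> borel_measurable borel"
    using cont by (rule borel_measurable_continuous_onI)
  have [measurable]: "fourier f \<in> borel_measurable borel" by measurable
  define L where "L n = (LINT \<xi>|lborel. iexp (\<xi> \<bullet> y) * complex_of_real (exp (- (s n)\<^sup>2 * (norm \<xi>)\<^sup>2)) * fourier f \<xi>)" for n
  \<comment> \<open>The damping disappears in the limit.\<close>
  have lim1: "L \<longlonglongrightarrow> (LINT \<xi>|lborel. iexp (\<xi> \<bullet> y) * fourier f \<xi>)"
    unfolding L_def
  proof (rule integral_dominated_convergence[where w = "\<lambda>\<xi>. norm (fourier f \<xi>)"])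
    show "AE \<xi> in lborel. (\<lambda>n. iexp (\<xi> \<bullet> y) * complex_of_real (exp (- (s n)\<^sup>2 * (norm \<xi>)\<^sup>2)) * fourier f \<xi>)
        \<longlonglongrightarrow> iexp (\<xi> \<bullet> y) * fourier f \<xi>"
    proof (rule AE_I2)
      fix \<xi> :: 'a
      have "(\<lambda>n. iexp (\<xi> \<bullet> y) * complex_of_real (exp (- (s n)\<^sup>2 * (norm \<xi>)\<^sup>2)) * fourier f \<xi>)
        \<longlonglongrightarrow> iexp (\<xi> \<bullet> y) * complex_of_real (exp (- 0\<^sup>2 * (norm \<xi>)\<^sup>2)) * fourier f \<xi>"
        by (intro tendsto_intros s0)
      then show "(\<lambda>n. iexp (\<xi> \<bullet> y) * complex_of_real (exp (- (s n)\<^sup>2 * (norm \<xi>)\<^sup>2)) * fourier f \<xi>)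
        \<longlonglongrightarrow> iexp (\<xi> \<bullet> y) * fourier f \<xi>" by simp
    qed
    show "AE \<xi> in lborel. norm (iexp (\<xi> \<bullet> y) * complex_of_real (exp (- (s n)\<^sup>2 * (norm \<xi>)\<^sup>2)) * fourier f \<xi>)
        \<le> norm (fourier f \<xi>)" for n
      by (intro AE_I2) (auto simp: norm_mult intro!: mult_left_le_one_le)
  qed (use ft in auto)
  \<comment> \<open>The damped integral is a Gaussian average. Substituting \<open>w = y + (2 * s n) *\<^sub>R v\<close> puts all the
    dependence on \<open>n\<close> into the argument of \<open>f\<close>.\<close>
  have L: "L n = complex_of_real ((2 * sqrt pi) ^ DIM('a)) *
      (LINT v|lborel. complex_of_real (exp (- (norm v)\<^sup>2)) * f (y + (2 * s n) *\<^sub>R v))" for n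
  proof -
    define \<delta> where "\<delta> = (s n)\<^sup>2"
    have \<delta>: "\<delta> > 0" using s[of n] by (simp add: \<delta>_def)
    define k where "k = (\<lambda>(\<xi>, w). iexp (\<xi> \<bullet> y) * complex_of_real (exp (- \<delta> * (norm \<xi>)\<^sup>2))
        * (exp (- \<i> * complex_of_real (\<xi> \<bullet> w)) * f w))"
    have [measurable]: "k \<in> borel_measurable (lborel \<Otimes>\<^sub>M lborel)"
      unfolding k_def by measurable
    have gauss: "integrable lborel (\<lambda>\<xi>::'a. exp (- \<delta> * (norm \<xi>)\<^sup>2))"
      using integrable_Re[OF gaussian_fourier(1)[OF \<delta>, of "0::'a"]] by simp
    have fe: "integrable lborel (\<lambda>w. exp (- \<i> * complex_of_real (\<xi> \<bullet> w)) * f w)" for \<xi>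
      using integrable_exp_mult[OF f, of "\<lambda>w. - (\<xi> \<bullet> w)"] by simp
    have kint: "integrable (lborel \<Otimes>\<^sub>M lborel) k"
    proof (rule lborel_pair.Fubini_integrable)
      show "integrable lborel (\<lambda>\<xi>. LINT w|lborel. norm (k (\<xi>, w)))"
        using gauss by (simp add: k_def norm_mult)
      show "AE \<xi> in lborel. integrable lborel (\<lambda>w. k (\<xi>, w))"
        using fe by (auto simp: k_def intro!: AE_I2 integrable_mult_right)
    qed measurable
    have "L n = (LINT \<xi>|lborel. LINT w|lborel. k (\<xi>, w))"
      unfolding L_def k_def fourier_def \<delta>_def by simp
    also have "\<dots> = (LINT w|lborel. LINT \<xi>|lborel. k (\<xi>, w))"
      using lborel_pair.Fubini_integral[of "\<lambda>\<xi> w. k (\<xi>, w)"] kint by simp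
    also have "\<dots> = (LINT w|lborel. complex_of_real (sqrt (pi / \<delta>) ^ DIM('a) * exp (- (norm (y - w))\<^sup>2 / (4 * \<delta>))) * f w)"
    proof (rule Bochner_Integration.integral_cong[OF refl])
      fix w :: 'a
      have eq: "k (\<xi>, w) = (iexp ((y - w) \<bullet> \<xi>) * complex_of_real (exp (- \<delta> * (norm \<xi>)\<^sup>2))) * f w" for \<xi>
      proof -
        have "iexp ((y - w) \<bullet> \<xi>) = iexp (\<xi> \<bullet> y) * exp (- \<i> * complex_of_real (\<xi> \<bullet> w))"
          by (simp add: exp_add[symmetric] inner_diff_left inner_commute algebra_simps)
        then show ?thesis by (simp add: k_def mult_ac)
      qed
      show "(LINT \<xi>|lborel. k (\<xi>, w)) = complex_of_real (sqrt (pi / \<delta>) ^ DIM('a) * exp (- (norm (y - w))\<^sup>2 / (4 * \<delta>))) * f w"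
        unfolding eq integral_mult_left_zero gaussian_fourier(2)[OF \<delta>] ..
    qed
    also have "\<dots> = \<bar>2 * s n\<bar> ^ DIM('a) *\<^sub>R (LINT v|lborel. complex_of_real (sqrt (pi / \<delta>) ^ DIM('a) *
        exp (- (norm (y - (y + (2 * s n) *\<^sub>R v)))\<^sup>2 / (4 * \<delta>))) * f (y + (2 * s n) *\<^sub>R v))"
      using s[of n] by (intro lborel_integral_affine) auto
    also have "\<dots> = \<bar>2 * s n\<bar> ^ DIM('a) *\<^sub>R (LINT v|lborel. complex_of_real (sqrt (pi / \<delta>) ^ DIM('a)) *
        (complex_of_real (exp (- (norm v)\<^sup>2)) * f (y + (2 * s n) *\<^sub>R v)))"
      using s[of n] by (simp add: \<delta>_def power_mult_distrib mult.assoc)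
    also have "\<dots> = complex_of_real (\<bar>2 * s n\<bar> ^ DIM('a) * sqrt (pi / \<delta>) ^ DIM('a)) *
        (LINT v|lborel. complex_of_real (exp (- (norm v)\<^sup>2)) * f (y + (2 * s n) *\<^sub>R v))"
      by (simp add: scaleR_conv_of_real)
    also have "\<bar>2 * s n\<bar> ^ DIM('a) * sqrt (pi / \<delta>) ^ DIM('a) = (2 * sqrt pi) ^ DIM('a)"
    proof -
      have "\<bar>2 * s n\<bar> * sqrt (pi / \<delta>) = 2 * sqrt pi"
        using s[of n] by (simp add: \<delta>_def real_sqrt_divide)
      then show ?thesis by (simp only: power_mult_distrib[symmetric])
    qed
    finally show ?thesis .
  qed
  obtain B where B: "\<And>w. norm (f w) \<le> B" using bdd unfolding bounded_iff by blast
  have gauss: "integrable lborel (\<lambda>v::'a. exp (- (norm v)\<^sup>2))"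
    using integrable_Re[OF gaussian_fourier(1)[of 1 "0::'a"]] by simp
  have gauss_eq: "(LINT v|lborel. complex_of_real (exp (- (norm (v::'a))\<^sup>2))) = complex_of_real (sqrt pi ^ DIM('a))"
    using gaussian_fourier(2)[of 1 "0::'a"] by simp
  have "(\<lambda>n. LINT v|lborel. complex_of_real (exp (- (norm v)\<^sup>2)) * f (y + (2 * s n) *\<^sub>R v))
      \<longlonglongrightarrow> (LINT v|lborel. complex_of_real (exp (- (norm (v::'a))\<^sup>2)) * f y)"
  proof (rule integral_dominated_convergence[where w = "\<lambda>v. exp (- (norm v)\<^sup>2) * B"])
    show "AE v in lborel. (\<lambda>n. complex_of_real (exp (- (norm v)\<^sup>2)) * f (y + (2 * s n) *\<^sub>R v))
        \<longlonglongrightarrow> complex_of_real (exp (- (norm (v::'a))\<^sup>2)) * f y"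
    proof (rule AE_I2)
      fix v :: 'a
      have "(\<lambda>n. y + (2 * s n) *\<^sub>R v) \<longlonglongrightarrow> y + (2 * 0) *\<^sub>R v"
        by (intro tendsto_intros s0)
      then have "(\<lambda>n. f (y + (2 * s n) *\<^sub>R v)) \<longlonglongrightarrow> f y"
        using cont by (intro continuous_on_tendsto_compose[OF cont]) auto
      then show "(\<lambda>n. complex_of_real (exp (- (norm v)\<^sup>2)) * f (y + (2 * s n) *\<^sub>R v))
        \<longlonglongrightarrow> complex_of_real (exp (- (norm (v::'a))\<^sup>2)) * f y"
        by (intro tendsto_intros)
    qed
  qed (use gauss B in \<open>auto simp: norm_mult\<close>)
  then have "L \<longlonglongrightarrow> complex_of_real ((2 * sqrt pi) ^ DIM('a)) * (complex_of_real (sqrt pi ^ DIM('a)) * f y)"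
    unfolding L integral_mult_left_zero gauss_eq by (intro tendsto_intros)
  then have "(LINT \<xi>|lborel. iexp (\<xi> \<bullet> y) * fourier f \<xi>)
      = complex_of_real ((2 * sqrt pi) ^ DIM('a)) * (complex_of_real (sqrt pi ^ DIM('a)) * f y)"
    by (rule LIMSEQ_unique[OF lim1])
  also have "\<dots> = complex_of_real ((2 * sqrt pi * sqrt pi) ^ DIM('a)) * f y"
    by (simp only: power_mult_distrib of_real_mult mult.assoc)
  also have "2 * sqrt pi * sqrt pi = 2 * pi" by simp
  finally show ?thesis by (simp add: inv_fourier_def)
qed

text \<open>
  A Fourier transform is bounded, which controls it on the unit ball; outside the unit ball the
  weight is at least 1.
\<close>

lemma integrable_fourier_of_weighted:
  fixes f :: "'a::euclidean_space \<Rightarrow> complex"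
  assumes f: "integrable lborel f" and a: "a \<ge> 0"
    and w: "integrable lborel (\<lambda>\<xi>. complex_of_real (norm \<xi> powr a) * fourier f \<xi>)"
  shows "integrable lborel (fourier f)"
proof -
  define M where "M = (LINT x|lborel. norm (f x))"
  have M: "M \<ge> 0" by (simp add: M_def)
  have [measurable]: "f \<in> borel_measurable borel"
    using borel_measurable_integrable[OF f] by simp
  have [measurable]: "fourier f \<in> borel_measurable borel" by measurable
  have ball: "integrable lborel (\<lambda>\<xi>::'a. M * indicator (cball 0 1) \<xi>)"
    by (intro integrable_mult_right) (auto intro!: integrable_real_indicator emeasure_lborel_cball_finite)
  show ?thesis
  proof (rule Bochner_Integration.integrable_bound[OF Bochner_Integration.integrable_add[OF ball integrable_norm[OF w]]])
    show "AE \<xi> in lborel. norm (fourier f \<xi>)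
        \<le> norm (M * indicator (cball 0 1) \<xi> + norm (complex_of_real (norm \<xi> powr a) * fourier f \<xi>))"
    proof (rule AE_I2)
      fix \<xi> :: 'a
      show "norm (fourier f \<xi>)
        \<le> norm (M * indicator (cball 0 1) \<xi> + norm (complex_of_real (norm \<xi> powr a) * fourier f \<xi>))"
      proof (cases "norm \<xi> \<le> 1")
        case True
        then show ?thesis using norm_fourier_le[of f \<xi>] M
          by (simp add: M_def[symmetric] abs_of_nonneg)
             (smt (verit) mult_nonneg_nonneg norm_ge_zero powr_ge_zero)
      next
        case False
        then have "norm \<xi> powr a \<ge> 1" using a by (simp add: ge_one_powr_ge_zero)
        then show ?thesis using False
          by (simp add: norm_mult mult_right_le_one_le mult_le_cancel_right1)
      qed
    qed
  qed measurable
qed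

section \<open>The second difference and its Fourier representation\<close>

text \<open>
  The average of the integrand of the singular integral over the two points \<open>x + z\<close> and \<open>x - z\<close>.
  The cancellation that the principal value provides is built into it.
\<close>

definition second_difference_quotient ::
    "('a::euclidean_space \<Rightarrow> real) \<Rightarrow> real \<Rightarrow> 'a \<Rightarrow> 'a \<Rightarrow> real" where
  "second_difference_quotient u a x z =
     (u x - (u (x + z) + u (x - z)) / 2) / norm z powr (real DIM('a) + a)"

text \<open>
  By Fourier inversion, the second difference of \<open>u\<close> at \<open>x\<close> with step \<open>z\<close> is the inverse transform at
  \<open>x\<close> of \<open>(1 - cos (\<xi> \<bullet> z)) * fourier v \<xi>\<close>. Dividing by the power of \<open>norm z\<close>, integrating over \<open>z\<close>
  and exchanging the integrals, the factor \<open>1 - cos (\<xi> \<bullet> z)\<close> integrates to the symbol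
  \<open>norm \<xi> powr a\<close> up to the constant. The integrand is absolutely integrable over all pairs
  \<open>(\<xi>, z)\<close>: integrating its norm over \<open>z\<close> gives, up to the constant, the norm of the weighted
  transform, which is integrable by assumption.
\<close>

theorem second_difference_integral:
  fixes u :: "'a::euclidean_space \<Rightarrow> real"
  defines "v \<equiv> \<lambda>y. complex_of_real (u y)"
  assumes a: "0 < a" "a < 2"
    and cont: "continuous_on UNIV u" and bdd: "bounded (range u)"
    and u: "integrable lborel u"
    and w: "integrable lborel (\<lambda>\<xi>. complex_of_real (norm \<xi> powr a) * fourier v \<xi>)"
  shows "integrable lborel (second_difference_quotient u a x)"
    and "complex_of_real (frac_const DIM('a) a * (LINT z|lborel. second_difference_quotient u a x z))
           = inv_fourier (\<lambda>\<xi>. complex_of_real (norm \<xi> powr a) * fourier v \<xi>) x"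
proof -
  let ?c = "frac_const DIM('a) a"
  let ?p = "real DIM('a) + a"
  let ?G = "second_difference_quotient u a x"
  have c: "?c > 0" using a by (rule frac_const_pos)
  have v: "integrable lborel v" unfolding v_def using u by simp
  have vc: "continuous_on UNIV v" unfolding v_def using cont by (intro continuous_intros)
  have vb: "bounded (range v)" using bdd by (simp add: v_def bounded_iff)
  have [measurable]: "v \<in> borel_measurable borel"
    using vc by (rule borel_measurable_continuous_onI)
  have [measurable]: "fourier v \<in> borel_measurable borel" by measurable
  have [measurable]: "u \<in> borel_measurable borel"
    using cont by (rule borel_measurable_continuous_onI)
  have ft: "integrable lborel (fourier v)"
    using v _ w by (rule integrable_fourier_of_weighted) (use a in simp)
  have inv: "(LINT \<xi>|lborel. iexp (\<xi> \<bullet> y) * fourier v \<xi>) = (2 * complex_of_real pi) ^ DIM('a) * v y" for y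
    using fourier_inversion[OF vc vb v ft, of y] by (simp add: inv_fourier_def field_simps)
  have ift: "integrable lborel (\<lambda>\<xi>. iexp (\<xi> \<bullet> y) * fourier v \<xi>)" for y
    by (rule integrable_exp_mult[OF ft]) measurable
  define h where "h = (\<lambda>(\<xi>, z). iexp (\<xi> \<bullet> x) * fourier v \<xi> * complex_of_real ((1 - cos (\<xi> \<bullet> z)) / norm z powr ?p))"
  have [measurable]: "h \<in> borel_measurable (lborel \<Otimes>\<^sub>M lborel)"
    unfolding h_def by measurable
  have hint: "integrable (lborel \<Otimes>\<^sub>M lborel) h"
  proof (rule lborel_pair.Fubini_integrable)
    have "(LINT z|lborel. norm (h (\<xi>, z))) = norm (complex_of_real (norm \<xi> powr a) * fourier v \<xi>) / ?c" for \<xi>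
    proof -
      have "norm (h (\<xi>, z)) = norm (fourier v \<xi>) * ((1 - cos (\<xi> \<bullet> z)) / norm z powr ?p)" for z
        unfolding h_def prod.case norm_mult norm_of_real by simp
      then show ?thesis
        by (simp only: integral_mult_right_zero integral_levy_kernel(2)[OF a])
           (simp add: norm_mult mult.commute)
    qed
    then show "integrable lborel (\<lambda>\<xi>. LINT z|lborel. norm (h (\<xi>, z)))"
      using integrable_norm[OF w] by simp
    show "AE \<xi> in lborel. integrable lborel (\<lambda>z. h (\<xi>, z))"
      unfolding h_def prod.case
      by (intro AE_I2 integrable_mult_right integrable_of_real integral_levy_kernel(1) a)
  qed measurable
  have inner: "(LINT \<xi>|lborel. h (\<xi>, z)) = (2 * complex_of_real pi) ^ DIM('a) * complex_of_real (?G z)" for z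
  proof -
    have cos: "complex_of_real (cos r) = (iexp r + iexp (- r)) / 2" for r
      by (simp add: cos_of_real[symmetric] cos_exp_eq)
    have "h (\<xi>, z) = (iexp (\<xi> \<bullet> x) * fourier v \<xi>
          - (iexp (\<xi> \<bullet> (x + z)) * fourier v \<xi> + iexp (\<xi> \<bullet> (x - z)) * fourier v \<xi>) / 2)
          / complex_of_real (norm z powr ?p)" for \<xi>
    proof -
      have "iexp (\<xi> \<bullet> (x + z)) = iexp (\<xi> \<bullet> x) * iexp (\<xi> \<bullet> z)"
        and "iexp (\<xi> \<bullet> (x - z)) = iexp (\<xi> \<bullet> x) * iexp (- (\<xi> \<bullet> z))"
        by (simp_all add: exp_add[symmetric] inner_add_right inner_diff_right algebra_simps)
      then show ?thesis
        unfolding h_def prod.case of_real_divide of_real_diff of_real_1 cos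
        by (simp add: algebra_simps add_divide_distrib diff_divide_distrib)
    qed
    then have "(LINT \<xi>|lborel. h (\<xi>, z)) =
        ((LINT \<xi>|lborel. iexp (\<xi> \<bullet> x) * fourier v \<xi>)
          - ((LINT \<xi>|lborel. iexp (\<xi> \<bullet> (x + z)) * fourier v \<xi>)
            + (LINT \<xi>|lborel. iexp (\<xi> \<bullet> (x - z)) * fourier v \<xi>)) / 2) / complex_of_real (norm z powr ?p)"
      using ift by (simp only: integral_divide_zero Bochner_Integration.integral_diff
         Bochner_Integration.integral_add Bochner_Integration.integrable_add integrable_divide)
    then show ?thesis
      unfolding inv by (simp add: v_def second_difference_quotient_def algebra_simps diff_divide_distrib add_divide_distrib)
  qed
  have "integrable lborel (\<lambda>z. LINT \<xi>|lborel. h (\<xi>, z))"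
    using lborel_pair.integrable_snd[of "\<lambda>\<xi> z. h (\<xi>, z)"] hint by simp
  then have "integrable lborel (\<lambda>z. (LINT \<xi>|lborel. h (\<xi>, z)) / (2 * complex_of_real pi) ^ DIM('a))"
    by (intro integrable_divide)
  moreover have "(LINT \<xi>|lborel. h (\<xi>, z)) / (2 * complex_of_real pi) ^ DIM('a) = complex_of_real (?G z)" for z
    unfolding inner by simp
  ultimately have "integrable lborel (\<lambda>z. complex_of_real (?G z))"
    by (simp only:)
  then show "integrable lborel ?G" by (simp add: complex_of_real_integrable_eq)
  have "(2 * complex_of_real pi) ^ DIM('a) * (LINT z|lborel. complex_of_real (?G z))
      = (LINT z|lborel. LINT \<xi>|lborel. h (\<xi>, z))"
    unfolding inner by simp
  also have "\<dots> = (LINT \<xi>|lborel. LINT z|lborel. h (\<xi>, z))"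
    using lborel_pair.Fubini_integral[of "\<lambda>\<xi> z. h (\<xi>, z)"] hint by simp
  also have "\<dots> = (LINT \<xi>|lborel. iexp (\<xi> \<bullet> x) * fourier v \<xi> * complex_of_real (norm \<xi> powr a / ?c))"
    unfolding h_def prod.case integral_mult_right_zero integral_complex_of_real integral_levy_kernel(2)[OF a] ..
  also have "\<dots> = (LINT \<xi>|lborel. iexp (\<xi> \<bullet> x) * (complex_of_real (norm \<xi> powr a) * fourier v \<xi>)) / complex_of_real ?c"
    unfolding integral_divide_zero[symmetric]
    by (intro Bochner_Integration.integral_cong) (simp_all add: mult_ac)
  finally have "complex_of_real ?c * ((2 * complex_of_real pi) ^ DIM('a) * (LINT z|lborel. complex_of_real (?G z)))
      = (LINT \<xi>|lborel. iexp (\<xi> \<bullet> x) * (complex_of_real (norm \<xi> powr a) * fourier v \<xi>))"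
    using c by simp
  then show "complex_of_real (?c * (LINT z|lborel. ?G z))
      = inv_fourier (\<lambda>\<xi>. complex_of_real (norm \<xi> powr a) * fourier v \<xi>) x"
    by (simp add: inv_fourier_def field_simps)
qed

section \<open>The principal value and the equality of the two definitions\<close>

text \<open>
  The region \<open>norm (x - y) > \<epsilon>\<close> is symmetric about \<open>x\<close>, so the integrand may be averaged with its
  reflection \<open>y \<mapsto> 2 *\<^sub>R x - y\<close>. Integrability on the region permits splitting the average.
\<close>

lemma pv_trunc_eq_second_difference:
  fixes u :: "'a::euclidean_space \<Rightarrow> real"
  assumes [measurable]: "u \<in> borel_measurable borel"
    and int: "set_integrable lborel {y. norm (x - y) > \<epsilon>} (frac_integrand \<alpha> u x)"
  shows "pv_trunc (frac_integrand \<alpha> u x) x \<epsilon>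
           = (LINT z|lborel. indicator {z. norm z > \<epsilon>} z * second_difference_quotient u (\<alpha> x) x z)"
proof -
  define F where "F = (\<lambda>y. indicator {y. norm (x - y) > \<epsilon>} y * frac_integrand \<alpha> u x y)"
  have F: "integrable lborel F" using int by (simp add: F_def set_integrable_def)
  then have [measurable]: "F \<in> borel_measurable borel"
    using borel_measurable_integrable by fastforce
  note aff = lborel_integrable_affine[OF F, of 1 x] lborel_integrable_affine[OF F, of "-1" x]
  have "pv_trunc (frac_integrand \<alpha> u x) x \<epsilon> = (LINT y|lborel. F y)"
    by (simp add: pv_trunc_def set_lebesgue_integral_def F_def)
  also have "\<dots> = ((LINT z|lborel. F (x + z)) + (LINT z|lborel. F (x - z))) / 2"
    using lborel_integral_affine[of F 1 x] lborel_integral_affine[of F "-1" x] by simp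
  also have "\<dots> = (LINT z|lborel. (F (x + z) + F (x - z)) / 2)"
    using aff by simp
  also have "\<dots> = (LINT z|lborel. indicator {z. norm z > \<epsilon>} z * second_difference_quotient u (\<alpha> x) x z)"
    by (intro Bochner_Integration.integral_cong)
       (auto simp: F_def frac_integrand_def second_difference_quotient_def indicator_def add_divide_distrib diff_divide_distrib)
  finally show ?thesis .
qed

text \<open>
  Once the truncated integrals are symmetrised their integrands are dominated by a single integrable
  function, so the limit over truncations is the integral over the whole space. Since the limit is
  known to exist, it is enough to follow it along one sequence.
\<close>

lemma pv_integral_eq_second_difference:
  fixes u :: "'a::euclidean_space \<Rightarrow> real"
  assumes u: "u \<in> borel_measurable borel"
    and pv: "pv_exists (frac_integrand \<alpha> u x) x"
    and G: "integrable lborel (second_difference_quotient u (\<alpha> x) x)"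
  shows "pv_integral (frac_integrand \<alpha> u x) x = (LINT z|lborel. second_difference_quotient u (\<alpha> x) x z)"
proof -
  let ?G = "second_difference_quotient u (\<alpha> x) x"
  let ?T = "pv_trunc (frac_integrand \<alpha> u x) x"
  obtain l where l: "(?T \<longlongrightarrow> l) (at_right 0)" using pv by (auto simp: pv_exists_def)
  define s where "s = (\<lambda>n. inverse (real (Suc n)))"
  have s: "s n > 0" for n by (simp add: s_def)
  have s0: "s \<longlonglongrightarrow> 0" unfolding s_def by (rule LIMSEQ_inverse_real_of_nat)
  have "filterlim s (at_right 0) sequentially"
    using s0 s by (auto simp: filterlim_at less_imp_neq[THEN not_sym] intro!: always_eventually)
  then have 1: "(\<lambda>n. ?T (s n)) \<longlonglongrightarrow> l"
    by (rule filterlim_compose[OF l])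
  have T: "?T (s n) = (LINT z|lborel. indicator {z. norm z > s n} z * ?G z)" for n
    using pv s[of n] by (intro pv_trunc_eq_second_difference u) (simp add: pv_exists_def)
  have [measurable]: "?G \<in> borel_measurable borel"
    using borel_measurable_integrable[OF G] by simp
  have "(\<lambda>n. LINT z|lborel. indicator {z. norm z > s n} z * ?G z) \<longlonglongrightarrow> (LINT z|lborel. ?G z)"
  proof (rule integral_dominated_convergence[where w = "\<lambda>z. norm (?G z)"])
    show "AE z in lborel. (\<lambda>n. indicator {z. norm z > s n} z * ?G z) \<longlonglongrightarrow> ?G z"
    proof (rule AE_I2)
      fix z :: 'a
      show "(\<lambda>n. indicator {z. norm z > s n} z * ?G z) \<longlonglongrightarrow> ?G z"
      \<comment> \<open>The origin lies outside every truncated region; there the quotient has value 0 by division by 0.\<close>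
      proof (cases "z = 0")
        case False
        then have "eventually (\<lambda>n. s n < norm z) sequentially"
          using s0 by (intro order_tendstoD) auto
        then have "eventually (\<lambda>n. indicator {z. norm z > s n} z * ?G z = ?G z) sequentially"
          by eventually_elim simp
        then show ?thesis by (rule tendsto_eventually)
      qed (simp add: second_difference_quotient_def)
    qed
  qed (use G in \<open>auto simp: indicator_def\<close>)
  then have "l = (LINT z|lborel. ?G z)"
    using 1 unfolding T by (rule LIMSEQ_unique[rotated])
  then show ?thesis
    using tendsto_Lim[OF _ l] by (simp add: pv_integral_def)
qed

lemma Cb2_continuous_bounded:
  assumes "u \<in> Cb2"
  shows "continuous_on UNIV u" "bounded (range u)"
proof -
  show "bounded (range u)" using assms by (simp add: Cb2_def)
  show "continuous_on UNIV u"
    using assms unfolding Cb2_def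
    by (auto intro!: continuous_at_imp_continuous_on dest: has_derivative_continuous)
qed

theorem theorem2p1:
  fixes \<alpha> :: "real ^ 'n \<Rightarrow> real"
    and u :: "real ^ 'n \<Rightarrow> real"
    and \<alpha>min \<alpha>max :: real
    and x :: "real ^ 'n"
  assumes "continuous_on UNIV \<alpha>"
    and "0 < \<alpha>min" and "\<And>y. \<alpha>min \<le> \<alpha> y" and "\<And>y. \<alpha> y \<le> \<alpha>max" and "\<alpha>max < 2"
    and "u \<in> Cb2"
    and "frac_laplacian_defined \<alpha> u x"
    and "fourier_frac_laplacian_defined \<alpha> u x"
  shows "complex_of_real (frac_laplacian \<alpha> u x) = fourier_frac_laplacian \<alpha> u x"
proof -
  have a: "0 < \<alpha> x" "\<alpha> x < 2"
    using assms(2) assms(3)[of x] assms(4)[of x] assms(5) by auto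
  note u = Cb2_continuous_bounded[OF assms(6)]
  have um: "u \<in> borel_measurable borel"
    using u(1) by (rule borel_measurable_continuous_onI)
  \<comment> \<open>At frequency 0 the Fourier integrand is \<open>u\<close> itself.\<close>
  have "fourier_defined (\<lambda>y. complex_of_real (u y)) 0"
    using assms(8) by (simp add: fourier_frac_laplacian_defined_def)
  then have int: "integrable lborel u"
    by (simp add: fourier_defined_def complex_of_real_integrable_eq)
  have "integrable lborel (\<lambda>\<xi>. iexp (\<xi> \<bullet> x) * frac_symbol \<alpha> u x \<xi>)"
    using assms(8) by (simp add: fourier_frac_laplacian_defined_def inv_fourier_defined_def)
  \<comment> \<open>Multiplying by the inverse character removes the factor of modulus 1.\<close>
  from integrable_exp_mult[OF this, of "\<lambda>\<xi>. - (\<xi> \<bullet> x)"]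
  have w: "integrable lborel (\<lambda>\<xi>. complex_of_real (norm \<xi> powr \<alpha> x) * fourier (\<lambda>y. complex_of_real (u y)) \<xi>)"
    by (simp add: frac_symbol_def exp_minus mult.assoc[symmetric])
  note main = second_difference_integral[OF a u int w, of x]
  have "pv_integral (frac_integrand \<alpha> u x) x = (LINT z|lborel. second_difference_quotient u (\<alpha> x) x z)"
    using um assms(7) main(1) unfolding frac_laplacian_defined_def
    by (rule pv_integral_eq_second_difference)
  then show ?thesis
    using main(2) by (simp add: frac_laplacian_def fourier_frac_laplacian_def frac_symbol_def[abs_def])
qed

end
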